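(* Let $S\subset\mathbb{R}^n$ and let $H:\mathbb{R}^n\times\mathbb{R}^n\to\mathbb{S}^p$ be a Subset-based Discrete-Time Exponential Matrix Control Barrier Function (SDTE-MCBF) for $S$, with constant $0<\gamma\le1$ on a domain $\mathcal{D}\supset S$, for the system $x_{k+1}=f(x_k)+g(x_k)u_k$. Then any control law $u(\cdot)$ such that $u(x_k)\in K_H(x_k)$ for all $k\ge0$ renders the safe set $S$ forward invariant; that is, if $x_0\in S$ and $x_{k+1}=f(x_k)+g(x_k)u(x_k)$ with $u(x_k)\in K_H(x_k)$ for all $k\ge 0$, then $x_k\in S$ for all $k\ge0$.
   Context: $\mathbb{S}^p$ is the set of real symmetric $p\times p$ matrices; $A\succeq B$ means $A-B$ is positive semidefinite. The functions $f:\mathbb{R}^n\to\mathbb{R}^n$, $g:\mathbb{R}^n\to\mathbb{R}^{n\times m}$ are locally Lipschitz; states $x_k\in\mathbb{R}^n$, inputs $u_k\in\mathbb{R}^m$. Weak safe subset function: $H:\mathbb{R}^n\times\mathbb{R}^n\to\mathbb{S}^p$ is a weak safe subset function for $S\subset\mathbb{R}^n$ if there is a domain $\mathcal{D}\supset S$ such that $\{z\in\mathbb{R}^n: H(z,x)\succeq0\}\subseteq S$ for all $x\in\mathcal{D}$. Safe subset function: a weak safe subset function for $S$ such that in addition $H(x,x)\succeq0$ for all $x\in S$. SDTE-MCBF: a safe subset function $H$ for $S$ such that there exist a constant $0<\gamma\le1$ and a domain $\mathcal{D}\supset S$ such that for all $x\in\mathcal{D}$ there is $u\in\mathbb{R}^m$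 with $H(f(x)+g(x)u,x)\succeq(1-\gamma)H(x,x)$. Set of inputs: $K_H(x)=\{u\in\mathbb{R}^m: H(f(x)+g(x)u,x)\succeq(1-\gamma)H(x,x)\}$. *)

theory Defs
  imports "HOL-Analysis.Analysis"
begin

definition sym_matrices :: "(real ^ 'p ^ 'p) set" where
  "sym_matrices = {A. transpose A = A}"

definition pos_semidef :: "real ^ 'p ^ 'p \<Rightarrow> bool" where
  "pos_semidef A \<longleftrightarrow> A \<in> sym_matrices \<and> (\<forall>v. 0 \<le> v \<bullet> (A *v v))"

definition loewner_ge :: "real ^ 'p ^ 'p \<Rightarrow> real ^ 'p ^ 'p \<Rightarrow> bool" (infix "\<succeq>" 50) where
  "A \<succeq> B \<longleftrightarrow> pos_semidef (A - B)"

(* For matrix-valued maps, the metric on real ^ 'm ^ 'n is that of the Frobenius norm. *)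
definition locally_lipschitz :: "('a::metric_space \<Rightarrow> 'b::metric_space) \<Rightarrow> bool" where
  "locally_lipschitz f \<longleftrightarrow> (\<forall>x. \<exists>e>0. \<exists>L. L-lipschitz_on (ball x e) f)"

(* "Domain" in the sense of analysis. *)
definition open_domain :: "'a::topological_space set \<Rightarrow> bool" where
  "open_domain D \<longleftrightarrow> D \<noteq> {} \<and> open D \<and> connected D"

definition weak_safe_subset_function ::
  "(real ^ 'n) set \<Rightarrow> ((real ^ 'n) \<times> (real ^ 'n) \<Rightarrow> real ^ 'p ^ 'p) \<Rightarrow> bool" where
  "weak_safe_subset_function S H \<longleftrightarrow>
     range H \<subseteq> sym_matrices \<and>
     (\<exists>D. open_domain D \<and> S \<subseteq> D \<and> (\<forall>x\<in>D. {z. H (z, x) \<succeq> 0} \<subseteq> S))"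

definition safe_subset_function ::
  "(real ^ 'n) set \<Rightarrow> ((real ^ 'n) \<times> (real ^ 'n) \<Rightarrow> real ^ 'p ^ 'p) \<Rightarrow> bool" where
  "safe_subset_function S H \<longleftrightarrow>
     weak_safe_subset_function S H \<and> (\<forall>x\<in>S. H (x, x) \<succeq> 0)"

definition input_set ::
  "(real ^ 'n \<Rightarrow> real ^ 'n) \<Rightarrow> (real ^ 'n \<Rightarrow> real ^ 'm ^ 'n) \<Rightarrow>
   ((real ^ 'n) \<times> (real ^ 'n) \<Rightarrow> real ^ 'p ^ 'p) \<Rightarrow> real \<Rightarrow> real ^ 'n \<Rightarrow> (real ^ 'm) set" where
  "input_set f g H \<gamma> x = {u. H (f x + g x *v u, x) \<succeq> (1 - \<gamma>) *\<^sub>R H (x, x)}"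

(* The constant and the domain are parameters, because the input set depends on the constant.
   The domain need not be the one witnessing the weak safe subset property. *)
definition sdte_mcbf ::
  "(real ^ 'n \<Rightarrow> real ^ 'n) \<Rightarrow> (real ^ 'n \<Rightarrow> real ^ 'm ^ 'n) \<Rightarrow> (real ^ 'n) set \<Rightarrow>
   ((real ^ 'n) \<times> (real ^ 'n) \<Rightarrow> real ^ 'p ^ 'p) \<Rightarrow> real \<Rightarrow> (real ^ 'n) set \<Rightarrow> bool" where
  "sdte_mcbf f g S H \<gamma> D \<longleftrightarrow>
     safe_subset_function S H \<and> 0 < \<gamma> \<and> \<gamma> \<le> 1 \<and> open_domain D \<and> S \<subseteq> D \<and>
     (\<forall>x\<in>D. \<exists>u. H (f x + g x *v u, x) \<succeq> (1 - \<gamma>) *\<^sub>R H (x, x))"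

end

theory Submission
  imports Defs
begin

text \<open>Positive semidefinite matrices form a convex cone, so \<open>\<succeq>\<close> is
  transitive and survives nonnegative scaling. For \<open>x\<close> in \<open>S\<close>,
  \<open>H (x, x)\<close> lies in the cone, hence so does its multiple by
  \<open>1 - \<gamma>\<close>; an admissible input makes \<open>H\<close> at the successor and
  \<open>x\<close> dominate that multiple, so it lies in the cone too. The weak safe subset property
  then puts the successor in \<open>S\<close>. This single step is
  \<open>input_set_invariant\<close>; induction on time does the rest.\<close>

lemma pos_semidef_add:
  assumes "pos_semidef A" and "pos_semidef B"
  shows "pos_semidef (A + B)"
  using assms
  by (auto simp: pos_semidef_def sym_matrices_def transpose_def vec_eq_iff
      matrix_vector_mult_add_rdistrib inner_add_right)

lemma pos_semidef_scaleR:
  assumes "pos_semidef A" and "0 \<le> c"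
  shows "pos_semidef (c *\<^sub>R A)"
  using assms
  by (auto simp: pos_semidef_def sym_matrices_def transpose_def vec_eq_iff
      scaleR_matrix_vector_assoc [symmetric])

lemma loewner_ge_trans:
  assumes "A \<succeq> B" and "B \<succeq> C"
  shows "A \<succeq> C"
  using pos_semidef_add [of "A - B" "B - C"] assms by (simp add: loewner_ge_def)

text \<open>Isolates one time step, for an arbitrary state and admissible input, so that the
  induction only has to follow the trajectory.\<close>

lemma input_set_invariant:
  assumes "safe_subset_function S H" and "\<gamma> \<le> 1"
    and "x \<in> S" and "u \<in> input_set f g H \<gamma> x"
  shows "f x + g x *v u \<in> S"
proof -
  have "H (x, x) \<succeq> 0"
    using assms by (simp add: safe_subset_function_def)
  \<comment> \<open>The bound \<open>\<gamma> \<le> 1\<close> makes the factor nonnegative.\<close>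
  then have "(1 - \<gamma>) *\<^sub>R H (x, x) \<succeq> 0"
    using pos_semidef_scaleR [of "H (x, x)" "1 - \<gamma>"] assms(2) by (simp add: loewner_ge_def)
  then have "H (f x + g x *v u, x) \<succeq> 0"
    using assms(4) loewner_ge_trans by (auto simp: input_set_def)
  \<comment> \<open>The domain supplied by the weak safe subset property contains \<open>S\<close>,
    so it contains \<open>x\<close>.\<close>
  then show ?thesis
    using assms(1,3) unfolding safe_subset_function_def weak_safe_subset_function_def by blast
qed

theorem theorem5:
  fixes f :: "real ^ 'n \<Rightarrow> real ^ 'n"
    and g :: "real ^ 'n \<Rightarrow> real ^ 'm ^ 'n"
    and S D :: "(real ^ 'n) set"
    and H :: "(real ^ 'n) \<times> (real ^ 'n) \<Rightarrow> real ^ 'p ^ 'p"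
    and \<gamma> :: real
    and u :: "real ^ 'n \<Rightarrow> real ^ 'm"
    and x :: "nat \<Rightarrow> real ^ 'n"
  assumes "locally_lipschitz f" and "locally_lipschitz g"
    and "sdte_mcbf f g S H \<gamma> D"
    and "\<And>k. x (Suc k) = f (x k) + g (x k) *v u (x k)"
    and "\<And>k. u (x k) \<in> input_set f g H \<gamma> (x k)"
    and "x 0 \<in> S"
  shows "\<forall>k. x k \<in> S"
proof
  fix k
  have "safe_subset_function S H" and "\<gamma> \<le> 1"
    using assms(3) by (simp_all add: sdte_mcbf_def)
  then show "x k \<in> S"
    by (induction k) (simp_all add: assms input_set_invariant)
qed

end
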